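(* For an integer $n>1$, let $\ell(\mathbb{Z}_n)$ be the minimum positive integer such that every minimal zero sequence $\alpha$ in $\mathbb{Z}_n$ of length at least $\ell(\mathbb{Z}_n)$ satisfies $\mathrm{Index}(\alpha)=n$. The values of $\ell(\mathbb{Z}_n)$ for all $n>1$ are: if $n\notin\{2,3,4,5,7\}$ then $\ell(\mathbb{Z}_n)=\lfloor n/2\rfloor+2$; if $n\in\{2,3,4,5,7\}$ then $\ell(\mathbb{Z}_n)=1$.
   Context: $\mathbb{Z}_n=\mathbb{Z}/n\mathbb{Z}$ is the additive group of integers modulo $n$. Sequences are finite, and terms may repeat. A sequence in $\mathbb{Z}_n$ is a zero sequence if the sum of its terms is the zero element of $\mathbb{Z}_n$. A sequence is zero-free if it contains no nonempty zero subsequence. A zero sequence is minimal if each of its nonempty proper subsequences is zero-free. For $a\in\mathbb{Z}_n$, $\overline{a}$ denotes the unique integer in $\{1,2,\dots,n\}$ belonging to the congruence class $a$ modulo $n$. For $\alpha=(a_1,\dots,a_k)$ put $L(\alpha)=\sum_{i=1}^k\overline{a_i}$, and for an integer $g$ put $g\alpha=(ga_1,\dots,ga_k)$. The index $\mathrm{Index}(\alpha)$ is the minimum of $L(g\alpha)$ over all integers $g$ coprime to $n$. $\lfloor x\rfloor$ denotes the greatest integer not exceeding $x$. *)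

theory Defs
  imports Complex_Main
    "HOL-Algebra.Elementary_Groups"
    "HOL-Library.Sublist"
    "HOL-Number_Theory.Cong"
begin

text \<open>
  The group of integers modulo \<open>n\<close> is \<^const>\<open>integer_mod_group\<close>; for \<open>n > 0\<close> its elements are
  the integers \<open>0, \<dots>, n - 1\<close>, standing for their congruence classes. The library writes this
  group multiplicatively: \<open>\<otimes>\<close> is addition modulo \<open>n\<close>, \<open>\<one>\<close> is the zero class, and
  \<open>a [^] g\<close> for an integer \<open>g\<close> is the multiple \<open>ga\<close>.
\<close>

definition sequence_in :: "nat \<Rightarrow> int list \<Rightarrow> bool" where
  "sequence_in n \<alpha> \<longleftrightarrow> set \<alpha> \<subseteq> carrier (integer_mod_group n)"

definition seq_sum :: "nat \<Rightarrow> int list \<Rightarrow> int" where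
  "seq_sum n \<alpha> = foldr (\<otimes>\<^bsub>integer_mod_group n\<^esub>) \<alpha> \<one>\<^bsub>integer_mod_group n\<^esub>"

definition zero_sequence :: "nat \<Rightarrow> int list \<Rightarrow> bool" where
  "zero_sequence n \<alpha> \<longleftrightarrow> sequence_in n \<alpha> \<and> seq_sum n \<alpha> = \<one>\<^bsub>integer_mod_group n\<^esub>"

definition zero_free :: "nat \<Rightarrow> int list \<Rightarrow> bool" where
  "zero_free n \<alpha> \<longleftrightarrow>
     sequence_in n \<alpha> \<and> \<not> (\<exists>\<beta>. subseq \<beta> \<alpha> \<and> \<beta> \<noteq> [] \<and> zero_sequence n \<beta>)"

text \<open>
  The empty sequence satisfies this definition vacuously. This does not affect \<open>ell\<close> below,
  which only concerns sequences of positive length.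
\<close>

definition minimal_zero_sequence :: "nat \<Rightarrow> int list \<Rightarrow> bool" where
  "minimal_zero_sequence n \<alpha> \<longleftrightarrow>
     zero_sequence n \<alpha> \<and> (\<forall>\<beta>. strict_subseq \<beta> \<alpha> \<and> \<beta> \<noteq> [] \<longrightarrow> zero_free n \<beta>)"

text \<open>The representative is taken in \<open>{1..n}\<close>, so the zero class is represented by \<open>n\<close>, not \<open>0\<close>.\<close>

definition representative :: "nat \<Rightarrow> int \<Rightarrow> nat" where
  "representative n a = (THE b. b \<in> {1..n} \<and> [int b = a] (mod int n))"

definition representative_sum :: "nat \<Rightarrow> int list \<Rightarrow> nat" where
  "representative_sum n \<alpha> = (\<Sum>a\<leftarrow>\<alpha>. representative n a)"

definition seq_scale :: "nat \<Rightarrow> int \<Rightarrow> int list \<Rightarrow> int list" where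
  "seq_scale n g \<alpha> = map (\<lambda>a. a [^]\<^bsub>integer_mod_group n\<^esub> g) \<alpha>"

definition seq_index :: "nat \<Rightarrow> int list \<Rightarrow> nat" where
  "seq_index n \<alpha> =
     (LEAST m. \<exists>g::int. coprime g (int n) \<and> m = representative_sum n (seq_scale n g \<alpha>))"

definition ell :: "nat \<Rightarrow> nat" where
  "ell n = (LEAST l. 0 < l \<and>
     (\<forall>\<alpha>. minimal_zero_sequence n \<alpha> \<and> l \<le> length \<alpha> \<longrightarrow> seq_index n \<alpha> = n))"

end

theory Submission
  imports Defs "HOL-Library.Multiset"
begin

text \<open>
  The upper bound is the Savchev--Chen structure theorem: after multiplication by a suitable unit,
  the representatives of a zero-free sequence of more than \<open>n / 2\<close> terms have sum less than \<open>n\<close>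
  (\<open>long_zero_free_sum_less\<close>). A minimal zero sequence with at least \<open>\<lfloor>n / 2\<rfloor> + 2\<close> terms leaves such
  a sequence when one term is removed. Putting the term back adds at most \<open>n\<close> to the sum of the
  representatives, which is a positive multiple of \<open>n\<close> below \<open>2 n\<close>, hence \<open>n\<close>.

  The structure theorem is proved for a zero-sum free multiset \<open>A\<close> in a finite subgroup \<open>G\<close> of an
  abelian group, with \<open>|G| < 2 |A|\<close> (\<open>long_zero_sum_free_multiples\<close>). Call a sub-multiset \<open>R\<close> rich
  if it has at least \<open>2 |R|\<close> subset sums, the empty sum included. A single term is rich and \<open>A\<close> is
  not, so there are maximal rich sub-multisets \<open>R\<close>. By maximality each term left over adds exactly
  one new subset sum to those of \<open>R\<close>. A set of sums determines the shift which adds just one element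
  (\<open>shift_unique\<close>), so all terms left over are equal to a single \<open>a\<close>
  (\<open>maximal_rich_extension\<close>). Reflected and joined with \<open>0\<close>, the elements of \<open>G\<close> that are not sums
  of \<open>A\<close> again form a set to which the shift by \<open>a\<close> adds one element, and so they determine \<open>a\<close>
  from \<open>A\<close> alone; if there are none, then \<open>a = - \<Sigma>A\<close>
  (\<open>gap_directionI\<close>, \<open>gap_direction_unique\<close>). So every maximal rich \<open>R\<close> leaves over copies
  of the same \<open>a\<close>, and a rich sub-multiset never contains all \<open>v\<close> copies of \<open>a\<close>. These
  copies have the \<open>v + 1\<close> sums \<open>0, a, \<dots>, v a\<close>. A term \<open>b\<close> outside \<open>a, \<dots>, v a\<close> would double their
  number and make a rich sub-multiset. So every term is a multiple \<open>f a\<close> with \<open>1 \<le> f \<le> v\<close>, and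
  adding the terms to the copies of \<open>a\<close> one by one extends the interval of multiples of \<open>a\<close> which
  are sums; it cannot wrap around, because that would produce the sum zero. In the cyclic
  group, the length of \<open>A\<close> forces \<open>a\<close> to be a generator.

  The bound is attained by \<open>1, \<dots>, 1, x, y, z\<close> with \<open>\<lfloor>n / 2\<rfloor> - 2\<close> ones and three terms close to
  \<open>n / 2\<close>, for even \<open>n \<ge> 6\<close> and for odd \<open>n \<ge> 9\<close> (\<open>even_example\<close>, \<open>odd_example\<close>). For the remaining
  moduli only lengths up to \<open>\<lfloor>n / 2\<rfloor> + 1\<close> need attention: up to three terms, one of the multipliers
  \<open>1\<close> and \<open>-1\<close> works, and four terms modulo \<open>7\<close> are a finite check.
\<close>

section \<open>Subset sums of zero-sum free multisets\<close>

definition multiple :: "nat \<Rightarrow> 'a::comm_monoid_add \<Rightarrow> 'a" where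
  "multiple j a = sum_mset (replicate_mset j a)"

lemma multiple_0 [simp]: "multiple 0 a = 0"
  by (simp add: multiple_def)

lemma multiple_Suc [simp]: "multiple (Suc j) a = a + multiple j a"
  by (simp add: multiple_def)

lemma multiple_add: "multiple (i + j) a = multiple i a + multiple j a"
  by (induction i) (simp_all add: algebra_simps)

definition subset_sums :: "'a::comm_monoid_add multiset \<Rightarrow> 'a set" where
  "subset_sums M = sum_mset ` {N. N \<subseteq># M}"

definition zero_sum_free :: "'a::comm_monoid_add multiset \<Rightarrow> bool" where
  "zero_sum_free M \<longleftrightarrow> (\<forall>N. N \<subseteq># M \<and> N \<noteq> {#} \<longrightarrow> sum_mset N \<noteq> 0)"

lemma subset_sums_empty [simp]: "subset_sums {#} = {0}"
  by (auto simp: subset_sums_def)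

lemma subset_add_mset_cases:
  assumes "N \<subseteq># add_mset a M"
  obtains "N \<subseteq># M" | N' where "N = add_mset a N'" "N' \<subseteq># M"
proof (cases "a \<in># N")
  case True
  then obtain N' where "N = add_mset a N'" by (meson multi_member_split)
  then show ?thesis using assms that by simp
next
  case False
  then show ?thesis using assms that(1)
    by (metis diff_single_trivial subset_eq_diff_conv add_mset_add_single)
qed

lemma subset_sums_add_mset: "subset_sums (add_mset a M) = subset_sums M \<union> (+) a ` subset_sums M"
proof
  show "subset_sums (add_mset a M) \<subseteq> subset_sums M \<union> (+) a ` subset_sums M"
  proof
    fix x assume "x \<in> subset_sums (add_mset a M)"
    then obtain N where N: "N \<subseteq># add_mset a M" "x = sum_mset N" by (auto simp: subset_sums_def)
    from N(1) show "x \<in> subset_sums M \<union> (+) a ` subset_sums M"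
      by (cases rule: subset_add_mset_cases) (use N(2) in \<open>auto simp: subset_sums_def\<close>)
  qed
  have "a + sum_mset N \<in> subset_sums (add_mset a M)" if "N \<subseteq># M" for N
    using that unfolding subset_sums_def by (intro image_eqI[of _ _ "add_mset a N"]) auto
  moreover have "sum_mset N \<in> subset_sums (add_mset a M)" if "N \<subseteq># M" for N
    using that unfolding subset_sums_def by (intro image_eqI[of _ _ N]) (auto simp: subset_mset.le_supI2 intro: subset_mset.order_trans)
  ultimately show "subset_sums M \<union> (+) a ` subset_sums M \<subseteq> subset_sums (add_mset a M)"
    by (auto simp: subset_sums_def)
qed

lemma finite_subset_sums [simp]: "finite (subset_sums M)"
  by (induction M) (auto simp: subset_sums_add_mset)

lemma sum_mset_in_subset_sums: "N \<subseteq># M \<Longrightarrow> sum_mset N \<in> subset_sums M"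
  by (auto simp: subset_sums_def)

lemma zero_in_subset_sums [simp]: "0 \<in> subset_sums M"
  using sum_mset_in_subset_sums[of "{#}" M] by simp

lemma total_in_subset_sums [simp]: "sum_mset M \<in> subset_sums M"
  by (simp add: sum_mset_in_subset_sums)

lemma member_in_subset_sums: "a \<in># M \<Longrightarrow> a \<in> subset_sums M"
  using sum_mset_in_subset_sums[of "{#a#}" M] by simp

lemma subset_sums_mono: "N \<subseteq># M \<Longrightarrow> subset_sums N \<subseteq> subset_sums M"
  unfolding subset_sums_def by (auto intro: subset_mset.order_trans)

lemma subset_sums_closed:
  assumes "set_mset M \<subseteq> G" "0 \<in> G" "\<And>x y. x \<in> G \<Longrightarrow> y \<in> G \<Longrightarrow> x + y \<in> G"
  shows "subset_sums M \<subseteq> G"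
  using assms(1) by (induction M) (auto simp: subset_sums_add_mset assms(2,3))

lemma zero_sum_free_mono: "zero_sum_free M \<Longrightarrow> N \<subseteq># M \<Longrightarrow> zero_sum_free N"
  unfolding zero_sum_free_def by (meson subset_mset.order_trans)

lemma zero_sum_free_sum_neq_0: "zero_sum_free M \<Longrightarrow> N \<subseteq># M \<Longrightarrow> N \<noteq> {#} \<Longrightarrow> sum_mset N \<noteq> 0"
  unfolding zero_sum_free_def by blast

text \<open>
  Complementary sub-multisets have complementary sums, so the subset sums are symmetric.
\<close>

lemma subset_sums_reflect:
  fixes M :: "'a::ab_group_add multiset"
  assumes "x \<in> subset_sums M"
  shows "sum_mset M - x \<in> subset_sums M"
proof -
  obtain N where N: "N \<subseteq># M" "x = sum_mset N" using assms by (auto simp: subset_sums_def)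
  then have "sum_mset M = sum_mset N + sum_mset (M - N)"
    by (metis subset_mset.add_diff_inverse sum_mset.union)
  then show ?thesis using N sum_mset_in_subset_sums[of "M - N" M] by (simp add: algebra_simps)
qed

lemma zero_sum_free_uminus_notin:
  fixes M :: "'a::ab_group_add multiset"
  assumes "zero_sum_free (M + K)" "K \<noteq> {#}"
  shows "- sum_mset K \<notin> subset_sums M"
proof
  assume "- sum_mset K \<in> subset_sums M"
  then obtain N where N: "N \<subseteq># M" "- sum_mset K = sum_mset N" by (auto simp: subset_sums_def)
  have "sum_mset (N + K) \<noteq> 0"
    by (rule zero_sum_free_sum_neq_0[OF assms(1)]) (use N assms(2) in auto)
  then show False by (simp add: N(2)[symmetric])
qed

lemma zero_sum_free_uminus_notin1:
  fixes M :: "'a::ab_group_add multiset"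
  assumes "zero_sum_free (add_mset a M)"
  shows "- a \<notin> subset_sums M"
  using zero_sum_free_uminus_notin[of M "{#a#}"] assms by simp

lemma card_subset_sums_add_mset:
  "card (subset_sums (add_mset a M)) = card (subset_sums M) + card ((+) a ` subset_sums M - subset_sums M)"
  unfolding subset_sums_add_mset by (subst Un_Diff_cancel[symmetric], subst card_Un_disjoint) auto

section \<open>Shifts that add one element\<close>

text \<open>
  If \<open>a + \<Sigma>M\<close> were a subset sum, then its reflection \<open>- a\<close> would be one as well. So each term
  added to a zero-sum free multiset contributes at least this new subset sum.
\<close>

lemma total_plus_new:
  fixes M :: "'a::ab_group_add multiset"
  assumes "- a \<notin> subset_sums M"
  shows "a + sum_mset M \<in> (+) a ` subset_sums M - subset_sums M"
  using subset_sums_reflect[of "a + sum_mset M" M] assms by (auto simp: algebra_simps)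

text \<open>
  If only one sum is new, it is the one of \<open>total_plus_new\<close>. Then \<open>a\<close> itself cannot be new, as
  \<open>\<Sigma>M\<close> is nonzero. The fact that \<open>a\<close> is an old sum excludes the degenerate case in
  \<open>shift_unique\<close>, in which \<open>S\<close> would meet the multiples of \<open>a\<close> in \<open>0\<close> only.
\<close>

lemma shift_one_new:
  fixes M :: "'a::ab_group_add multiset"
  assumes "zero_sum_free (add_mset a M)" "M \<noteq> {#}"
    and "card (subset_sums (add_mset a M)) \<le> Suc (card (subset_sums M))"
  shows "(+) a ` subset_sums M - subset_sums M = {a + sum_mset M}" "a \<in> subset_sums M"
proof -
  have new: "a + sum_mset M \<in> (+) a ` subset_sums M - subset_sums M"
    by (intro total_plus_new zero_sum_free_uminus_notin1 assms(1))
  have "card ((+) a ` subset_sums M - subset_sums M) \<le> Suc 0"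
    using assms(3) by (simp add: card_subset_sums_add_mset)
  then show eq: "(+) a ` subset_sums M - subset_sums M = {a + sum_mset M}"
    using new by (auto simp: card_le_Suc0_iff_eq simp del: Diff_iff)
  have "sum_mset M \<noteq> 0"
    by (rule zero_sum_free_sum_neq_0[OF assms(1) _ assms(2)]) simp
  moreover have "a \<in> (+) a ` subset_sums M" using image_eqI[of a "(+) a" 0] by simp
  moreover have "a \<in> {a + sum_mset M}" if "a \<notin> subset_sums M"
    unfolding eq[symmetric] using \<open>a \<in> (+) a ` subset_sums M\<close> that by blast
  ultimately show "a \<in> subset_sums M" by auto
qed

text \<open>
  Typical sets of this kind are progressions \<open>0, a, \<dots>, k a\<close> with \<open>k \<ge> 1\<close>, possibly joined by
  cosets of the subgroup generated by \<open>a\<close>; the claim is that the difference can be read off. Since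
  \<open>S\<close> is finite, shifting by \<open>a\<close> loses exactly \<open>0\<close> and gains \<open>y\<close>, and likewise for \<open>b\<close> and \<open>z\<close>.
  Shifting by \<open>a + b\<close> can be computed in both orders. One order shows that it loses \<open>a\<close>,
  the other that it loses \<open>b\<close> but, when \<open>a \<noteq> b\<close>, keeps \<open>a\<close>.
\<close>

lemma shift_unique:
  fixes S :: "'a::ab_group_add set"
  assumes "finite S" "0 \<in> S" "a \<in> S" "b \<in> S" "- a \<notin> S" "- b \<notin> S"
    and "(+) a ` S - S = {y}" "(+) b ` S - S = {z}"
  shows "a = b"
proof (rule ccontr)
  assume "a \<noteq> b"
  have shift: "(+) c ` S = insert w (S - {0})" if "- c \<notin> S" "(+) c ` S - S = {w}" for c w
  proof (rule card_subset_eq)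
    show "finite (insert w (S - {0}))" using assms(1) by simp
    have "0 \<notin> (+) c ` S"
    proof
      assume "0 \<in> (+) c ` S"
      then obtain s where "s \<in> S" "0 = c + s" by blast
      then have "- c = s" by (metis add.inverse_unique)
      then show False using that(1) \<open>s \<in> S\<close> by simp
    qed
    then show "(+) c ` S \<subseteq> insert w (S - {0})" using that(2) by blast
    have "w \<notin> S" using that(2) by blast
    then have "card (insert w (S - {0})) = card S"
      using card_Suc_Diff1[OF assms(1,2)] assms(1) by simp
    then show "card ((+) c ` S) = card (insert w (S - {0}))"
      using card_image[of "(+) c" S] by simp
  qed
  note A = shift[OF assms(5,7)] and B = shift[OF assms(6,8)]
  have "(+) (a + b) ` S = (+) b ` ((+) a ` S)" by (simp add: image_image algebra_simps)
  also have "\<dots> = insert (b + y) ((+) b ` S - {b})"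
    unfolding A using assms(2) by (auto simp: image_iff)
  also have "\<dots> = insert (b + y) (insert z (S - {0}) - {b})" by (simp only: B)
  finally have 1: "(+) (a + b) ` S = insert (b + y) (insert z (S - {0}) - {b})" .
  have "(+) (a + b) ` S = (+) a ` ((+) b ` S)" by (simp add: image_image algebra_simps)
  also have "\<dots> = insert (a + z) ((+) a ` S - {a})"
    unfolding B using assms(2) by (auto simp: image_iff)
  also have "\<dots> = insert (a + z) (insert y (S - {0}) - {a})" by (simp only: A)
  finally have 2: "(+) (a + b) ` S = insert (a + z) (insert y (S - {0}) - {a})" .
  have "a \<noteq> 0" using assms(2,5) by auto
  then have "a \<in> (+) (a + b) ` S" unfolding 1 using assms(3) \<open>a \<noteq> b\<close> by auto
  then have "z = 0" unfolding 2 by auto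
  then show False using assms(2,8) by blast
qed

section \<open>Maximal rich sub-multisets\<close>

lemma multiple_eq_0_imp:
  fixes a :: "'a::ab_group_add"
  assumes "zero_sum_free M" "replicate_mset r a \<subseteq># M" "j \<le> r" "multiple j a = 0"
  shows "j = 0"
proof -
  have "replicate_mset j a \<subseteq># M"
    by (rule subset_mset.order_trans[OF _ assms(2)]) (use assms(3) in \<open>auto simp: replicate_mset_msubseteq_iff\<close>)
  then show ?thesis using zero_sum_free_sum_neq_0[OF assms(1), of "replicate_mset j a"] assms(4)
    by (auto simp: multiple_def)
qed

lemma inj_on_multiple:
  fixes a :: "'a::ab_group_add"
  assumes "\<And>j. 0 < j \<Longrightarrow> j \<le> r \<Longrightarrow> multiple j a \<noteq> 0"
  shows "inj_on (\<lambda>j. multiple j a) {..r}"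
proof (rule linorder_inj_onI')
  fix i j assume ij: "i \<in> {..r}" "j \<in> {..r}" "i < j"
  have "multiple j a = multiple (j - i) a + multiple i a" using ij by (simp flip: multiple_add)
  then show "multiple i a \<noteq> multiple j a" using assms[of "j - i"] ij by auto
qed

text \<open>
  A sub-multiset \<open>R\<close> counts as rich if \<open>2 * size R \<le> card (subset_sums R)\<close>. In a maximal rich \<open>R\<close>
  above \<open>R0\<close>, adding any further term \<open>e\<close> of \<open>A\<close> increases the number of sums by at least one, but
  not by two, since otherwise \<open>R\<close> with \<open>e\<close> would be rich too. So \<open>shift_one_new\<close> and \<open>shift_unique\<close>
  apply to all such \<open>e\<close> and show that they coincide.
\<close>

lemma maximal_rich_extension:
  fixes A :: "'a::ab_group_add multiset"
  assumes zf: "zero_sum_free A" and poor: "card (subset_sums A) < 2 * size A"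
    and "R0 \<subseteq># A" "R0 \<noteq> {#}" "2 * size R0 \<le> card (subset_sums R0)"
  obtains R a r where "R0 \<subseteq># R" "A = R + replicate_mset r a" "0 < r"
    "card (subset_sums R) = 2 * size R" "(+) a ` subset_sums R - subset_sums R = {a + sum_mset R}"
proof -
  let ?P = "\<lambda>R. R0 \<subseteq># R \<and> R \<subseteq># A \<and> 2 * size R \<le> card (subset_sums R)"
  have "\<exists>R. ?P R \<and> (\<forall>R'. ?P R' \<longrightarrow> size R' \<le> size R)"
  proof (rule ex_has_greatest_nat)
    show "?P R0" using assms by simp
    show "\<forall>R. ?P R \<longrightarrow> size R < Suc (size A)" by (auto intro: size_mset_mono simp: less_Suc_eq_le)
  qed
  then obtain R where R: "?P R" and max: "\<And>R'. ?P R' \<Longrightarrow> size R' \<le> size R" by blast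
  have "R \<noteq> {#}" using R assms(4) by auto
  have left: "card (subset_sums R) = 2 * size R \<and> (+) e ` subset_sums R - subset_sums R = {e + sum_mset R} \<and>
      e \<in> subset_sums R \<and> - e \<notin> subset_sums R" if "e \<in># A - R" for e
  proof -
    have sub: "add_mset e R \<subseteq># A" using R that
      by (metis add_mset_add_single mset_subset_eq_mono_add_left_cancel single_subset_iff
          subset_mset.add_diff_inverse)
    then have zf': "zero_sum_free (add_mset e R)" using zf zero_sum_free_mono by blast
    have "\<not> ?P (add_mset e R)" using max[of "add_mset e R"] by auto
    moreover have "R0 \<subseteq># add_mset e R" using R by (simp add: subset_mset.order_trans[of _ R])
    ultimately have "card (subset_sums (add_mset e R)) < 2 * size R + 2" using sub by auto
    moreover have "card ((+) e ` subset_sums R - subset_sums R) \<noteq> 0"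
      using total_plus_new[OF zero_sum_free_uminus_notin1[OF zf']]
      by (metis card_0_eq empty_iff finite_Diff finite_subset_sums finite_imageI)
    ultimately have "card (subset_sums R) = 2 * size R" "card (subset_sums (add_mset e R)) \<le> Suc (card (subset_sums R))"
      using R card_subset_sums_add_mset[of e R] by linarith+
    then show ?thesis using shift_one_new[OF zf' \<open>R \<noteq> {#}\<close>] zero_sum_free_uminus_notin1[OF zf'] by simp
  qed
  have "R \<noteq> A" using R poor by auto
  then have "A - R \<noteq> {#}" using R
    by (metis subset_mset.add_diff_inverse add.right_neutral)
  then obtain a where a: "a \<in># A - R" by blast
  have "e = a" if "e \<in># A - R" for e
    using shift_unique[of "subset_sums R" e a] left[OF that] left[OF a] by simp
  then have "set_mset (A - R) \<subseteq> {a}" by blast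
  then have eq: "A - R = replicate_mset (size (A - R)) a" by (rule set_mset_subset_singletonD)
  have "A = R + replicate_mset (size (A - R)) a"
    unfolding eq[symmetric] using R by simp
  moreover have "0 < size (A - R)" using a by (auto simp: nonempty_has_size[symmetric])
  ultimately show ?thesis using that[of R "size (A - R)" a] left[OF a] R by simp
qed

section \<open>The common difference of the gaps\<close>

text \<open>
  The reflection \<open>x \<mapsto> - x\<close> turns the progression of missing elements, which ends in \<open>- a\<close>, into
  one that starts in \<open>a\<close>; with \<open>0\<close> in front it is a set to which \<open>shift_unique\<close> applies.
\<close>

definition reflected_gaps :: "'a::ab_group_add set \<Rightarrow> 'a multiset \<Rightarrow> 'a set" where
  "reflected_gaps G A = insert 0 (uminus ` (G - subset_sums A))"

text \<open>
  The characterisation of the term \<open>a\<close> left over by a maximal rich sub-multiset of \<open>A\<close>, in terms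
  of \<open>G\<close> and \<open>A\<close> only. If no element of \<open>G\<close> is missing, there are no gaps to look at, but then the
  progression of sums closes up and its last element \<open>\<Sigma>A\<close> is \<open>- a\<close>.
\<close>

definition gap_direction :: "'a::ab_group_add set \<Rightarrow> 'a multiset \<Rightarrow> 'a \<Rightarrow> bool" where
  "gap_direction G A a \<longleftrightarrow>
     (G \<subseteq> subset_sums A \<longrightarrow> a = - sum_mset A) \<and>
     (\<not> G \<subseteq> subset_sums A \<longrightarrow> a \<in> reflected_gaps G A \<and> - a \<notin> reflected_gaps G A \<and>
        (\<exists>y. (+) a ` reflected_gaps G A - reflected_gaps G A = {y}))"

lemma gap_direction_unique:
  assumes "finite G" "gap_direction G A a" "gap_direction G A b"
  shows "a = b"
proof (cases "G \<subseteq> subset_sums A")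
  case True
  then have "a = - sum_mset A" "b = - sum_mset A"
    using assms(2,3) unfolding gap_direction_def by blast+
  then show ?thesis by (rule trans[OF _ sym])
next
  case False
  let ?F = "reflected_gaps G A"
  have F: "finite ?F" "0 \<in> ?F" using assms(1) by (auto simp: reflected_gaps_def)
  obtain y where a: "a \<in> ?F" "- a \<notin> ?F" "(+) a ` ?F - ?F = {y}"
    using assms(2) False unfolding gap_direction_def by blast
  obtain z where b: "b \<in> ?F" "- b \<notin> ?F" "(+) b ` ?F - ?F = {z}"
    using assms(3) False unfolding gap_direction_def by blast
  show ?thesis by (rule shift_unique[OF F a(1) b(1) a(2) b(2) a(3) b(3)])
qed

text \<open>
  A shift that adds a single element to the sums of \<open>R\<close> goes on to add at most one element with
  every further copy of \<open>a\<close>.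
\<close>

lemma subset_sums_add_replicate:
  fixes R :: "'a::ab_group_add multiset"
  assumes "(+) a ` subset_sums R - subset_sums R \<subseteq> {a + sum_mset R}"
  shows "subset_sums (R + replicate_mset r a) \<subseteq> subset_sums R \<union> (\<lambda>j. multiple j a + sum_mset R) ` {1..r}"
    and "(+) a ` subset_sums (R + replicate_mset r a) - subset_sums (R + replicate_mset r a)
           \<subseteq> {a + sum_mset (R + replicate_mset r a)}"
proof (induction r)
  case (Suc r)
  let ?T = "subset_sums (R + replicate_mset r a)" and ?s = "sum_mset (R + replicate_mset r a)"
  have T: "subset_sums (R + replicate_mset (Suc r) a) = ?T \<union> (+) a ` ?T"
    by (simp add: subset_sums_add_mset)
  have T': "?T \<union> (+) a ` ?T \<subseteq> insert (a + ?s) ?T"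
    using Suc(2) by blast
  have s: "a + ?s = multiple (Suc r) a + sum_mset R"
    by (simp add: multiple_def add.assoc add.commute[of "sum_mset R"])
  have diff: "X - (Z \<union> Y) \<subseteq> {w}" if "X \<subseteq> insert w Y" for X Y Z :: "'a set" and w
    using that by blast
  {
    case 1
    have "insert (a + ?s) ?T \<subseteq> subset_sums R \<union> (\<lambda>j. multiple j a + sum_mset R) ` {1..Suc r}"
      unfolding s using Suc(1) by (force simp del: multiple_Suc)
    then show ?case using T T' by blast
  next
    case 2
    have "(+) a ` (?T \<union> (+) a ` ?T) \<subseteq> insert (a + (a + ?s)) ((+) a ` ?T)"
      using image_mono[OF T', of "(+) a"] by (simp only: image_insert)
    also have "a + (a + ?s) = a + sum_mset (R + replicate_mset (Suc r) a)"
      by simp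
    finally show ?case unfolding T by (rule diff)
  }
next
  case 0
  {
    case 1
    show ?case by simp
  next
    case 2
    show ?case using assms by (simp only: replicate_mset_0 add_0_right)
  }
qed

text \<open>
  Suppose that \<open>- a\<close> is missing from the sums of \<open>A\<close>. Going backwards by \<open>a\<close> from a missing \<open>x\<close>,
  one can only leave the missing elements at \<open>x = a + \<Sigma>A\<close>, since this is the only sum gained in a
  shift by \<open>a\<close>. That is the condition on the reflected gaps.

  Suppose that \<open>- a\<close> is a sum. It was not yet a sum of \<open>R\<close>, so it is one of the elements
  \<open>j a + \<Sigma>R\<close> added by the copies of \<open>a\<close>, and \<open>j\<close> must be the last index \<open>r\<close>, as the next step would
  give a zero sum. It remains to exclude missing elements. Starting from a missing \<open>x\<close> and adding
  \<open>a\<close> repeatedly, one could leave the missing elements only from \<open>- a\<close>, which is not missing, so \<open>r\<close>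
  elements \<open>j a + x\<close> are missing. Together with the \<open>r\<close> elements \<open>j a + \<Sigma>R\<close> they lie outside the \<open>2 |R|\<close> sums of \<open>R\<close>,
  so that \<open>|G| \<ge> 2 |R| + 2 r = 2 |A|\<close>, a contradiction.
\<close>

lemma gap_directionI:
  fixes A :: "'a::ab_group_add multiset"
  assumes G: "finite G" "0 \<in> G" "\<And>x y. x \<in> G \<Longrightarrow> y \<in> G \<Longrightarrow> x + y \<in> G" "\<And>x. x \<in> G \<Longrightarrow> - x \<in> G"
    and A: "zero_sum_free A" "set_mset A \<subseteq> G" "card G < 2 * size A"
    and AR: "A = R + replicate_mset r a" and "0 < r" "R \<noteq> {#}"
    and card: "card (subset_sums R) = 2 * size R" and new: "(+) a ` subset_sums R - subset_sums R = {a + sum_mset R}"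
  shows "gap_direction G A a"
proof -
  define C where "C = G - subset_sums A"
  have SG: "subset_sums A \<subseteq> G" by (rule subset_sums_closed) (use G A in auto)
  have RG: "subset_sums R \<subseteq> G" using SG subset_sums_mono[of R A] by (auto simp: AR)
  have aA: "a \<in># A" using AR \<open>0 < r\<close> by auto
  then have aG: "a \<in> G" using A by auto
  have a0: "a \<noteq> 0" using zero_sum_free_sum_neq_0[OF A(1), of "{#a#}"] aA by auto
  have "A \<noteq> {#}" using aA by auto
  have s0: "sum_mset A \<noteq> 0" by (rule zero_sum_free_sum_neq_0[OF A(1) subset_mset.order_refl]) fact
  have newA: "x = a + sum_mset A" if "x \<notin> subset_sums A" "x - a \<in> subset_sums A" for x
  proof -
    have "x \<in> (+) a ` subset_sums A" using that(2) by (intro image_eqI[of _ _ "x - a"]) auto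
    then show ?thesis using subset_sums_add_replicate(2)[of a R r] new that(1) AR by auto
  qed
  have tG: "multiple j a \<in> G" for j by (induction j) (use G aG in auto)
  have multiples: "j = 0" if "multiple j a = 0" "j \<le> r" for j
    by (rule multiple_eq_0_imp[OF A(1)]) (use AR that in auto)
  have outside: "multiple j a + sum_mset R \<in> subset_sums A - subset_sums R" if "j \<in> {1..r}" for j
  proof
    have sub: "R + replicate_mset j a \<subseteq># A"
      using that by (auto simp: AR replicate_mset_msubseteq_iff)
    then show "multiple j a + sum_mset R \<in> subset_sums A"
      using sum_mset_in_subset_sums[OF sub] by (simp add: multiple_def algebra_simps)
    show "multiple j a + sum_mset R \<notin> subset_sums R"
    proof
      assume "multiple j a + sum_mset R \<in> subset_sums R"
      from subset_sums_reflect[OF this] have "- sum_mset (replicate_mset j a) \<in> subset_sums R"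
        by (simp add: multiple_def)
      then show False
        using zero_sum_free_uminus_notin[OF zero_sum_free_mono[OF A(1) sub]] that by auto
    qed
  qed
  have inj: "inj_on (\<lambda>j. multiple j a) {..r}" by (rule inj_on_multiple) (use multiples in auto)
  show ?thesis
  proof (cases "- a \<in> subset_sums A")
    case True
    have "- a \<notin> subset_sums R" using zero_sum_free_uminus_notin1[of a R] zero_sum_free_mono[OF A(1), of "add_mset a R"] AR \<open>0 < r\<close>
      by (auto simp: single_subset_iff)
    then obtain j where j: "j \<in> {1..r}" "- a = multiple j a + sum_mset R"
      using True subset_sums_add_replicate(1)[of a R r] new AR by auto
    have "multiple (Suc j) a + sum_mset R = 0" by (simp add: add.assoc j(2)[symmetric])
    then have "sum_mset (R + replicate_mset (Suc j) a) = 0"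
      by (simp add: multiple_def add.assoc add.commute[of "sum_mset R"])
    then have "\<not> R + replicate_mset (Suc j) a \<subseteq># A" 
      using zero_sum_free_sum_neq_0[OF A(1)] \<open>R \<noteq> {#}\<close> by (metis union_eq_empty)
    then have "\<not> Suc j \<le> r"
      by (simp add: AR replicate_mset_msubseteq_iff del: replicate_mset_Suc)
    then have "j = r" using j by auto
    moreover have "multiple r a + sum_mset R = sum_mset A" by (simp add: AR multiple_def add.commute)
    ultimately have eq: "a = - sum_mset A" using j(2) by (metis minus_minus)
    have "C = {}"
    proof (rule ccontr)
      assume "C \<noteq> {}"
      then obtain x where x: "x \<in> C" by blast
      have "multiple j a + x \<in> C" for j
      proof (induction j)
        case (Suc j)
        have "multiple (Suc j) a + x \<notin> subset_sums A"
        proof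
          assume "multiple (Suc j) a + x \<in> subset_sums A"
          define y where "y = multiple j a + x"
          have "a + y \<in> subset_sums A" using \<open>multiple (Suc j) a + x \<in> subset_sums A\<close> by (simp add: y_def add.assoc)
          from subset_sums_reflect[OF this] have "sum_mset A - y - a \<in> subset_sums A" by (simp add: algebra_simps)
          moreover have "y \<notin> subset_sums A" using Suc by (simp add: y_def C_def)
          then have "sum_mset A - y \<notin> subset_sums A" using subset_sums_reflect[of "sum_mset A - y" A] by auto
          ultimately have "sum_mset A - y = a + sum_mset A" by (intro newA)
          then have "y = - a" by (simp add: eq_neg_iff_add_eq_0 algebra_simps)
          then show False using \<open>y \<notin> subset_sums A\<close> True by simp
        qed
        moreover have "multiple (Suc j) a + x \<in> G" using G x tG[of "Suc j"] by (auto simp: C_def simp del: multiple_Suc)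
        ultimately show ?case by (simp add: C_def)
      qed (use x in simp)
      then have X: "(\<lambda>j. multiple j a + x) ` {1..r} \<subseteq> G - subset_sums A" by (auto simp: C_def)
      have Y: "(\<lambda>j. multiple j a + sum_mset R) ` {1..r} \<subseteq> subset_sums A - subset_sums R" using outside by auto
      have ix: "inj_on (\<lambda>j. multiple j a + w) {1..r}" for w
        using inj by (auto simp: inj_on_def)
      have "r + r = card ((\<lambda>j. multiple j a + x) ` {1..r} \<union> (\<lambda>j. multiple j a + sum_mset R) ` {1..r})"
      proof (subst card_Un_disjoint)
        show "(\<lambda>j. multiple j a + x) ` {1..r} \<inter> (\<lambda>j. multiple j a + sum_mset R) ` {1..r} = {}"
          using X Y by blast
      qed (simp_all only: card_image[OF ix] card_atLeastAtMost finite_imageI finite_atLeastAtMost diff_Suc_1 Suc_eq_plus1[symmetric])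
      also have "\<dots> \<le> card (G - subset_sums R)"
      proof (rule card_mono)
        have "subset_sums R \<subseteq> subset_sums A" by (rule subset_sums_mono) (simp add: AR)
        then show "(\<lambda>j. multiple j a + x) ` {1..r} \<union> (\<lambda>j. multiple j a + sum_mset R) ` {1..r} \<subseteq> G - subset_sums R"
          using X Y SG by blast
      qed (use G(1) in simp)
      also have "\<dots> = card G - 2 * size R" using RG card by (simp add: card_Diff_subset)
      finally show False using A(3) \<open>0 < r\<close> by (auto simp: AR)
    qed
    then show ?thesis using eq by (auto simp: gap_direction_def C_def)
  next
    case False
    define F where "F = reflected_gaps G A"
    have F: "x \<in> F \<longleftrightarrow> x = 0 \<or> - x \<in> C" for x
      unfolding F_def reflected_gaps_def C_def[symmetric] by (auto intro: image_eqI[of _ _ "- x"])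
    have aC: "- a \<in> C" using False G aG by (auto simp: C_def)
    have "a \<in> F" "- a \<notin> F" using aC a0 member_in_subset_sums[OF aA] by (auto simp: F C_def)
    moreover have "(+) a ` F - F = {- sum_mset A}"
    proof
      show "(+) a ` F - F \<subseteq> {- sum_mset A}"
      proof safe
        fix y assume y: "y \<in> F" "a + y \<notin> F"
        have "y \<noteq> 0" using y \<open>a \<in> F\<close> by auto
        then have "- y \<in> C" using y(1) by (simp add: F)
        then have "- y \<in> G" "- y \<notin> subset_sums A" by (auto simp: C_def)
        have "- (a + y) = - y - a" by (simp add: algebra_simps)
        moreover have "- y - a \<in> G" using G(3)[OF \<open>- y \<in> G\<close> G(4)[OF aG]] by simp
        ultimately have "- y - a \<in> subset_sums A" using y(2) unfolding F C_def by (metis DiffI)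
        then have "- y = a + sum_mset A" using \<open>- y \<notin> subset_sums A\<close> newA by blast
        then show "a + y = - sum_mset A" by (metis add.commute add_diff_cancel_left' diff_minus_eq_add minus_diff_eq minus_minus)
      qed
      have "- sum_mset A \<notin> F" using s0 by (auto simp: F C_def)
      moreover have "a + sum_mset A \<in> C"
        using total_plus_new[OF False] G(3)[OF aG subsetD[OF SG total_in_subset_sums]] by (simp add: C_def)
      then have "- (a + sum_mset A) \<in> F" by (simp only: F minus_minus) simp
      then have "a + - (a + sum_mset A) \<in> (+) a ` F" by (rule imageI)
      then have "- sum_mset A \<in> (+) a ` F" by simp
      ultimately show "{- sum_mset A} \<subseteq> (+) a ` F - F" by blast
    qed
    ultimately show ?thesis using aC unfolding gap_direction_def C_def F_def[symmetric] by blast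
  qed
qed

section \<open>The structure of long zero-sum free multisets\<close>

lemma subset_sums_replicate: "subset_sums (replicate_mset v a) = (\<lambda>j. multiple j a) ` {..v}"
proof (induction v)
  case (Suc v)
  have "subset_sums (replicate_mset (Suc v) a) = (\<lambda>j. multiple j a) ` ({..v} \<union> Suc ` {..v})"
    by (simp add: subset_sums_add_mset Suc image_Un image_image)
  also have "{..v} \<union> Suc ` {..v} = {..Suc v}"
    by (auto simp: image_Suc_atMost)
  finally show ?case .
qed simp

text \<open>
  The weights \<open>f\<close> write all terms as multiples of one term \<open>a\<close>. The last conclusion says that the
  order of \<open>a\<close> exceeds the total weight; since the total weight is at least \<open>size A\<close>, this makes \<open>a\<close>
  a generator when \<open>G\<close> is cyclic.
\<close>

theorem long_zero_sum_free_multiples: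
  fixes A :: "'a::ab_group_add multiset"
  assumes G: "finite G" "0 \<in> G" "\<And>x y. x \<in> G \<Longrightarrow> y \<in> G \<Longrightarrow> x + y \<in> G" "\<And>x. x \<in> G \<Longrightarrow> - x \<in> G"
    and A: "zero_sum_free A" "set_mset A \<subseteq> G" "card G < 2 * size A"
  obtains a f where "a \<in># A" "\<And>b. b \<in># A \<Longrightarrow> 0 < f b \<and> b = multiple (f b) a"
    "(\<Sum>b\<in>#A. f b) < card G" "\<And>j. 0 < j \<Longrightarrow> j \<le> (\<Sum>b\<in>#A. f b) \<Longrightarrow> multiple j a \<noteq> 0"
proof -
  have SG: "subset_sums A \<subseteq> G" by (rule subset_sums_closed) (use G A in auto)
  then have "card (subset_sums A) \<le> card G" using G(1) by (intro card_mono)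
  then have poor: "card (subset_sums A) < 2 * size A" using A(3) by simp
  obtain c where c: "c \<in># A" using A(3) by fastforce
  have "c \<noteq> 0" using zero_sum_free_sum_neq_0[OF A(1), of "{#c#}"] c by auto
  obtain R a r where R: "{#c#} \<subseteq># R" "A = R + replicate_mset r a" "0 < r"
    "card (subset_sums R) = 2 * size R" "(+) a ` subset_sums R - subset_sums R = {a + sum_mset R}"
  proof (rule maximal_rich_extension[OF A(1) poor])
    show "2 * size {#c#} \<le> card (subset_sums {#c#})" using \<open>c \<noteq> 0\<close> by (simp add: subset_sums_add_mset)
  qed (use c in auto)
  have "R \<noteq> {#}" using R(1) by auto
  then have ga: "gap_direction G A a" using gap_directionI[OF G A R(2,3)] R(4,5) by blast
  have aA: "a \<in># A" using R(2,3) by simp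
  define v where "v = count A a"
  have vA: "replicate_mset v a \<subseteq># A" by (simp add: v_def flip: count_le_replicate_mset_subset_eq)
  have v0: "0 < v" using aA by (simp add: v_def)
  \<comment> \<open>A maximal rich extension of \<open>R0\<close> leaves over a further copy of \<open>a\<close>, one more than \<open>A\<close> has.\<close>
  have not_rich: "card (subset_sums R0) < 2 * size R0"
    if R0: "R0 \<subseteq># A" "replicate_mset v a \<subseteq># R0" for R0
  proof (rule ccontr)
    assume "\<not> card (subset_sums R0) < 2 * size R0"
    moreover have "R0 \<noteq> {#}" using R0(2) v0 by auto
    ultimately obtain R b r where R: "R0 \<subseteq># R" "A = R + replicate_mset r b" "0 < r"
      "card (subset_sums R) = 2 * size R" "(+) b ` subset_sums R - subset_sums R = {b + sum_mset R}"
      using maximal_rich_extension[OF A(1) poor R0(1)] by (metis not_less)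
    then have "R \<noteq> {#}" using \<open>R0 \<noteq> {#}\<close> by auto
    then have "b = a" using gap_directionI[OF G A R(2,3)] R ga G(1) gap_direction_unique by blast
    then have "replicate_mset v a + replicate_mset r a \<subseteq># A"
      unfolding R(2) using subset_mset.order_trans[OF R0(2) R(1)] by simp
    moreover have "replicate_mset v a + replicate_mset r a = replicate_mset (v + r) a"
      by (simp add: multiset_eq_iff)
    ultimately have "replicate_mset (v + r) a \<subseteq># A" by simp
    then show False using \<open>0 < r\<close> by (simp add: v_def flip: count_le_replicate_mset_subset_eq)
  qed
  have times0: "j = 0" if "multiple j a = 0" "j \<le> v" for j
    by (rule multiple_eq_0_imp[OF A(1) vA that(2,1)])
  \<comment> \<open>Otherwise \<open>b\<close> doubles the \<open>v + 1\<close> sums of the copies of \<open>a\<close>, which yields a rich sub-multiset.\<close>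
  have small: "\<exists>j. 0 < j \<and> j \<le> v \<and> b = multiple j a" if b: "b \<in># A" for b
  proof (rule ccontr)
    assume neg: "\<not> ?thesis"
    have "b \<noteq> a" using neg v0 by (auto dest!: spec[of _ 1])
    have sub: "add_mset b (replicate_mset v a) \<subseteq># A"
      using vA b \<open>b \<noteq> a\<close> by (auto simp: subseteq_mset_def)
    let ?I = "subset_sums (replicate_mset v a)"
    have cI: "card ?I = Suc v"
      unfolding subset_sums_replicate by (subst card_image[OF inj_on_multiple]) (use times0 in auto)
    have "?I \<inter> (+) b ` ?I = {}"
    proof safe
      fix x assume "b + x \<in> ?I" "x \<in> ?I"
      then obtain i j where ij: "i \<le> v" "j \<le> v" "b + multiple j a = multiple i a" by (auto simp: subset_sums_replicate)
      show "b + x \<in> {}"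
      proof (cases "j < i")
        case True
        have "multiple i a = multiple (i - j) a + multiple j a" using True by (simp flip: multiple_add)
        then have "b = multiple (i - j) a" using ij(3) by simp
        moreover have "0 < i - j" "i - j \<le> v" using True ij by auto
        ultimately show ?thesis using neg by blast
      next
        case False
        then have "multiple j a = multiple (j - i) a + multiple i a" by (simp flip: multiple_add)
        then have "b + multiple (j - i) a = 0" using ij(3) by (simp add: algebra_simps)
        then have "- b = multiple (j - i) a" by (simp add: neg_eq_iff_add_eq_0)
        then have "- b \<in> ?I" using ij by (auto simp: subset_sums_replicate)
        then show ?thesis using zero_sum_free_uminus_notin1[OF zero_sum_free_mono[OF A(1) sub]] by blast
      qed
    qed
    then have "card (subset_sums (add_mset b (replicate_mset v a))) = 2 * Suc v"
      unfolding subset_sums_add_mset by (subst card_Un_disjoint) (auto simp: card_image cI)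
    then show False using not_rich[OF sub] by simp
  qed
  define f where "f b = (if b = a then 1 else SOME j. 0 < j \<and> j \<le> v \<and> b = multiple j a)" for b
  have f: "0 < f b \<and> f b \<le> v \<and> b = multiple (f b) a" if "b \<in># A" for b
    using someI_ex[OF small[OF that]] v0 by (auto simp: f_def)
  \<comment> \<open>The weight of a new term is at most \<open>v\<close>, so the shifted interval of multiples joins the old one
    without a gap; it does not reach a multiple that is zero, because \<open>- b\<close> is not a sum.\<close>
  have interval: "replicate_mset v a + N \<subseteq># A \<Longrightarrow>
      (let s = v + (\<Sum>b\<in>#N. f b) in
         subset_sums (replicate_mset v a + N) = (\<lambda>j. multiple j a) ` {..s} \<and> (\<forall>j. multiple j a = 0 \<and> j \<le> s \<longrightarrow> j = 0))" for N
  proof (induction N)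
    case empty
    then show ?case using times0 by (auto simp: subset_sums_replicate)
  next
    case (add b N)
    define s where "s = v + (\<Sum>b\<in>#N. f b)"
    let ?N = "replicate_mset v a + N"
    have bA: "b \<in># A" using add.prems by (auto dest: mset_subset_eqD)
    have subN: "add_mset b ?N \<subseteq># A" using add.prems by simp
    have "?N \<subseteq># A" by (rule subset_mset.order_trans[OF _ subN]) simp
    then have IH: "subset_sums ?N = (\<lambda>j. multiple j a) ` {..s}" "\<And>j. multiple j a = 0 \<Longrightarrow> j \<le> s \<Longrightarrow> j = 0"
      using add.IH by (auto simp: s_def Let_def)
    define k where "k = f b"
    have k: "0 < k" "k \<le> s" "b = multiple k a" using f[OF bA] by (auto simp: k_def s_def)
    have "- b \<notin> subset_sums ?N" using zero_sum_free_uminus_notin1[OF zero_sum_free_mono[OF A(1) subN]] .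
    then have "- b \<noteq> multiple j a" if "j \<le> s" for j using that unfolding IH by auto
    then have gap: "multiple (k + j) a \<noteq> 0" if "j \<le> s" for j
      using that k(3) by (auto simp: multiple_add neg_eq_iff_add_eq_0)
    have "subset_sums (add_mset b ?N) = (\<lambda>j. multiple j a) ` ({..s} \<union> (+) k ` {..s})"
      unfolding subset_sums_add_mset IH k(3) by (auto simp: multiple_add image_image image_Un)
    also have "{..s} \<union> (+) k ` {..s} = {..s + k}"
    proof
      show "{..s + k} \<subseteq> {..s} \<union> (+) k ` {..s}"
      proof
        fix x assume "x \<in> {..s + k}"
        then show "x \<in> {..s} \<union> (+) k ` {..s}"
          by (cases "x \<le> s") (use k(2) in \<open>auto intro!: image_eqI[of _ _ "x - k"]\<close>)
      qed
    qed auto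
    finally have 1: "subset_sums (add_mset b ?N) = (\<lambda>j. multiple j a) ` {..s + k}" .
    have 2: "j = 0" if "multiple j a = 0" "j \<le> s + k" for j
    proof (cases "j \<le> s")
      case False
      then have "j - k \<le> s" "k + (j - k) = j" using that(2) k(2) by auto
      then show ?thesis using gap[of "j - k"] that(1) by simp
    qed (use IH that in auto)
    have "v + (\<Sum>b\<in>#add_mset b N. f b) = s + k" by (simp add: s_def k_def)
    then show ?case using 1 2 by (simp add: Let_def)
  qed
  define N where "N = A - replicate_mset v a"
  have AN: "A = replicate_mset v a + N" using vA by (simp add: N_def)
  define s where "s = (\<Sum>b\<in>#A. f b)"
  have s: "s = v + (\<Sum>b\<in>#N. f b)" unfolding s_def by (subst AN) (simp add: f_def)
  have fin: "subset_sums A = (\<lambda>j. multiple j a) ` {..s}" "\<And>j. multiple j a = 0 \<Longrightarrow> j \<le> s \<Longrightarrow> j = 0"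
    using interval[of N] by (auto simp: Let_def s simp flip: AN)
  have "card (subset_sums A) = Suc s"
    unfolding fin(1) by (subst card_image[OF inj_on_multiple]) (use fin(2) in auto)
  then have "s < card G" using \<open>card (subset_sums A) \<le> card G\<close> by simp
  then show ?thesis using that[of a f] aA f fin(2) unfolding s_def by auto
qed

section \<open>Cyclic groups inside the circle group\<close>

text \<open>
  The group of reals modulo \<open>1\<close> contains a copy of the integers modulo \<open>n\<close>, namely the classes
  of the fractions \<open>k / n\<close>, for all \<open>n\<close> at once. So results on finite subgroups of a type of class
  \<^class>\<open>ab_group_add\<close> apply to every modulus.
\<close>

quotient_type circle = real / "\<lambda>x y. x - y \<in> \<int>"
proof (rule equivpI)
  show "reflp (\<lambda>x y::real. x - y \<in> \<int>)" by (auto simp: reflp_def)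
  show "symp (\<lambda>x y::real. x - y \<in> \<int>)"
    by (rule sympI) (metis Ints_minus minus_diff_eq)
  show "transp (\<lambda>x y::real. x - y \<in> \<int>)"
  proof (rule transpI)
    fix x y z :: real assume "x - y \<in> \<int>" "y - z \<in> \<int>"
    then have "(x - y) + (y - z) \<in> \<int>" by (rule Ints_add)
    then show "x - z \<in> \<int>" by simp
  qed
qed

instantiation circle :: ab_group_add
begin

lift_definition zero_circle :: circle is 0 .

lift_definition plus_circle :: "circle \<Rightarrow> circle \<Rightarrow> circle" is "(+)"
proof -
  fix a b c d :: real assume "a - b \<in> \<int>" "c - d \<in> \<int>"
  then have "(a - b) + (c - d) \<in> \<int>" by (rule Ints_add)
  then show "a + c - (b + d) \<in> \<int>" by (simp add: algebra_simps)
qed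

lift_definition uminus_circle :: "circle \<Rightarrow> circle" is uminus
proof -
  fix a b :: real assume "a - b \<in> \<int>"
  then have "- (a - b) \<in> \<int>" by (rule Ints_minus)
  then show "- a - - b \<in> \<int>" by simp
qed

definition minus_circle :: "circle \<Rightarrow> circle \<Rightarrow> circle" where
  "minus_circle x y = x + - y"

instance
proof
  fix a b c :: circle
  show "a + b + c = a + (b + c)" by transfer simp
  show "a + b = b + a" by transfer simp
  show "0 + a = a" by transfer simp
  show "- a + a = 0" by transfer simp
  show "a - b = a + - b" by (rule minus_circle_def)
qed

end

lift_definition residue :: "nat \<Rightarrow> int \<Rightarrow> circle" is "\<lambda>n k. real_of_int k / real n" .

lemma residue_add: "residue n (j + k) = residue n j + residue n k"
  by transfer (simp add: add_divide_distrib)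

lemma residue_0 [simp]: "residue n 0 = 0"
  by transfer simp

lemma residue_minus: "residue n (- k) = - residue n k"
  by transfer simp

lemma residue_eq_0_iff:
  assumes "n > 0"
  shows "residue n k = 0 \<longleftrightarrow> int n dvd k"
proof -
  have "real_of_int k / real n \<in> \<int> \<longleftrightarrow> int n dvd k"
  proof
    assume "real_of_int k / real n \<in> \<int>"
    then obtain i where "real_of_int k / real n = of_int i" by (auto elim: Ints_cases)
    then have "real_of_int k = of_int (int n * i)" using assms by (simp add: field_simps)
    then show "int n dvd k" by (simp only: of_int_eq_iff) simp
  next
    assume "int n dvd k"
    then show "real_of_int k / real n \<in> \<int>" using assms by (auto elim!: dvdE)
  qed
  then show ?thesis by (transfer fixing: n) simp
qed

lemma residue_eq_iff:
  assumes "n > 0"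
  shows "residue n j = residue n k \<longleftrightarrow> [j = k] (mod int n)"
proof -
  have "residue n j = residue n k \<longleftrightarrow> residue n (j - k) = 0"
    using residue_add[of n j "- k"] by (simp add: residue_minus)
  then show ?thesis using assms by (simp add: residue_eq_0_iff cong_iff_dvd_diff)
qed

lemma range_residue:
  assumes "n > 0"
  shows "range (residue n) = residue n ` {0..<int n}"
proof -
  have "residue n k \<in> residue n ` {0..<int n}" for k
    by (rule image_eqI[of _ _ "k mod int n"]) (use assms in \<open>auto simp: residue_eq_iff\<close>)
  then show ?thesis by blast
qed

lemma multiple_residue: "multiple j (residue n k) = residue n (int j * k)"
  by (induction j) (simp_all add: distrib_right residue_add)

lemma sum_residue_mset: "sum_mset (image_mset (residue n) (mset xs)) = residue n (sum_list xs)"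
  by (induction xs) (simp_all add: residue_add)

lemma subseq_of_submultiset:
  assumes "N \<subseteq># image_mset f (mset xs)"
  obtains ys where "subseq ys xs" "image_mset f (mset ys) = N"
proof -
  have "\<exists>ys. subseq ys xs \<and> image_mset f (mset ys) = N"
    using assms
  proof (induction xs arbitrary: N)
    case (Cons x xs)
    then have "N \<subseteq># add_mset (f x) (image_mset f (mset xs))" by simp
    then show ?case
    proof (cases rule: subset_add_mset_cases)
      case 1
      then show ?thesis using Cons.IH by (meson list_emb_Cons)
    next
      case (2 N')
      then obtain ys where "subseq ys xs" "image_mset f (mset ys) = N'" using Cons.IH by blast
      then show ?thesis using 2 by (intro exI[of _ "x # ys"]) simp
    qed
  qed simp
  then show ?thesis using that by blast
qed

section \<open>Zero sequences and representatives as integers\<close>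

lemma seq_sum_eq: "seq_sum n xs = sum_list xs mod int n"
proof (induction xs)
  case (Cons x xs)
  then show ?case by (simp add: seq_sum_def mod_add_right_eq)
qed (simp add: seq_sum_def)

lemma sequence_in_iff: "n > 0 \<Longrightarrow> sequence_in n xs \<longleftrightarrow> set xs \<subseteq> {0..<int n}"
  by (simp add: sequence_in_def carrier_integer_mod_group)

lemma zero_sequence_iff: "n > 0 \<Longrightarrow> zero_sequence n xs \<longleftrightarrow> set xs \<subseteq> {0..<int n} \<and> int n dvd sum_list xs"
  by (simp add: zero_sequence_def sequence_in_iff seq_sum_eq dvd_eq_mod_eq_0)

lemma set_mono_subseq: "subseq ys xs \<Longrightarrow> set ys \<subseteq> set xs"
  by (auto simp: subseq_conv_nths dest: in_set_nthsD)

lemma zero_free_iff: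
  assumes "n > 0"
  shows "zero_free n xs \<longleftrightarrow> set xs \<subseteq> {0..<int n} \<and>
    (\<forall>ys. subseq ys xs \<and> ys \<noteq> [] \<longrightarrow> \<not> int n dvd sum_list ys)"
  unfolding zero_free_def sequence_in_iff[OF assms] zero_sequence_iff[OF assms]
  using set_mono_subseq[of _ xs] by blast

lemma minimal_zero_sequence_iff:
  assumes "n > 0"
  shows "minimal_zero_sequence n xs \<longleftrightarrow> set xs \<subseteq> {0..<int n} \<and> int n dvd sum_list xs \<and>
     (\<forall>ys. subseq ys xs \<and> ys \<noteq> [] \<and> int n dvd sum_list ys \<longrightarrow> ys = xs)"
    (is "?L \<longleftrightarrow> ?R")
proof
  assume L: ?L
  have "ys = xs" if "subseq ys xs" "ys \<noteq> []" "int n dvd sum_list ys" for ys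
  proof (rule ccontr)
    assume "ys \<noteq> xs"
    then have "zero_free n ys" using L that by (auto simp: minimal_zero_sequence_def strict_subseq_def)
    then show False using that assms by (auto simp: zero_free_iff)
  qed
  then show ?R using L assms by (auto simp: minimal_zero_sequence_def zero_sequence_iff)
next
  assume R: ?R
  have "zero_free n ys" if "strict_subseq ys xs" for ys
    unfolding zero_free_iff[OF assms]
  proof (intro conjI allI impI notI)
    show "set ys \<subseteq> {0..<int n}" using R that set_mono_subseq[of ys xs] by (auto simp: strict_subseq_def)
    fix zs assume zs: "subseq zs ys \<and> zs \<noteq> []" "int n dvd sum_list zs"
    then have "subseq zs xs" using that subseq_order.order_trans[of zs ys xs] by (auto simp: strict_subseq_def)
    then have "zs = xs" using R zs by blast
    then show False using that zs subseq_order.antisym[of ys xs] by (auto simp: strict_subseq_def)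
  qed
  then show ?L using R assms by (auto simp: minimal_zero_sequence_def zero_sequence_iff)
qed

lemma representative_eqI:
  assumes "1 \<le> b" "b \<le> n" "[int b = a] (mod int n)"
  shows "representative n a = b"
  unfolding representative_def
proof (rule the_equality)
  fix c assume c: "c \<in> {1..n} \<and> [int c = a] (mod int n)"
  then have "[int c = int b] (mod int n)" using assms(3) cong_sym cong_trans by blast
  then have "int n dvd int c - int b" by (simp add: cong_iff_dvd_diff)
  moreover have "\<bar>int c - int b\<bar> < int n" using c assms by auto
  ultimately show "c = b" using dvd_imp_le_int[of "int c - int b" "int n"] by fastforce
qed (use assms in auto)

lemma representative_props:
  assumes "n > 0"
  shows "1 \<le> representative n a" "representative n a \<le> n" "[int (representative n a) = a] (mod int n)"
proof -
  define b where "b = (if a mod int n = 0 then n else nat (a mod int n))"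
  have "0 \<le> a mod int n" "a mod int n < int n" using assms by auto
  then have b: "1 \<le> b" "b \<le> n" "[int b = a] (mod int n)"
    by (auto simp: b_def cong_def)
  then show "1 \<le> representative n a" "representative n a \<le> n" "[int (representative n a) = a] (mod int n)"
    using representative_eqI[OF b] by auto
qed

lemma representative_cong:
  assumes "n > 0" "[a = b] (mod int n)"
  shows "representative n a = representative n b"
  by (rule representative_eqI)
    (use representative_props[OF assms(1), of b] assms(2) cong_sym cong_trans in blast)+

lemma representative_sum_scale:
  assumes "n > 0"
  shows "representative_sum n (seq_scale n g xs) = (\<Sum>a\<leftarrow>xs. representative n (g * a))"
  unfolding representative_sum_def seq_scale_def
  by (induction xs) (auto simp: int_pow_integer_mod_group intro!: representative_cong assms)

lemma representative_sum_cong: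
  assumes "n > 0"
  shows "[int (\<Sum>a\<leftarrow>xs. representative n (g * a)) = g * sum_list xs] (mod int n)"
proof (induction xs)
  case (Cons a xs)
  then show ?case using representative_props(3)[OF assms, of "g * a"]
    by (simp add: distrib_left cong_add)
qed simp

text \<open>
  For a zero sequence all numbers \<open>L(g\<alpha>)\<close> are positive multiples of \<open>n\<close>, so the index is \<open>n\<close> as soon
  as one of them is \<open>n\<close>.
\<close>

lemma representative_sum_ge:
  assumes "n > 0" "int n dvd sum_list xs" "xs \<noteq> []"
  shows "n dvd (\<Sum>a\<leftarrow>xs. representative n (g * a))" "n \<le> (\<Sum>a\<leftarrow>xs. representative n (g * a))"
proof -
  let ?L = "\<Sum>a\<leftarrow>xs. representative n (g * a)"
  have "int n dvd int ?L"
    using representative_sum_cong[OF assms(1), of g xs] assms(2) cong_dvd_iff dvd_mult by blast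
  then show "n dvd ?L" by simp
  moreover have "0 < ?L"
    using assms(3) representative_props(1)[OF assms(1)] by (cases xs) (auto simp: Suc_le_eq)
  ultimately show "n \<le> ?L" by (rule dvd_imp_le)
qed

lemma seq_index_eq_iff:
  assumes "n > 0" "int n dvd sum_list xs" "xs \<noteq> []"
  shows "seq_index n xs = n \<longleftrightarrow>
    (\<exists>g. coprime g (int n) \<and> (\<Sum>a\<leftarrow>xs. representative n (g * a)) = n)"
proof -
  let ?P = "\<lambda>m. \<exists>g::int. coprime g (int n) \<and> m = representative_sum n (seq_scale n g xs)"
  have "?P (representative_sum n (seq_scale n 1 xs))" by (intro exI[of _ 1]) simp
  then have "?P (seq_index n xs)" unfolding seq_index_def by (rule LeastI)
  then obtain h where h: "coprime h (int n)" "seq_index n xs = (\<Sum>a\<leftarrow>xs. representative n (h * a))"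
    by (auto simp: representative_sum_scale assms(1))
  show ?thesis
  proof
    assume "seq_index n xs = n"
    then show "\<exists>g. coprime g (int n) \<and> (\<Sum>a\<leftarrow>xs. representative n (g * a)) = n" using h by auto
  next
    assume "\<exists>g. coprime g (int n) \<and> (\<Sum>a\<leftarrow>xs. representative n (g * a)) = n"
    then have "?P n" by (auto simp: representative_sum_scale assms(1))
    then have "seq_index n xs \<le> n" unfolding seq_index_def by (rule Least_le)
    then show "seq_index n xs = n" using h(2) representative_sum_ge(2)[OF assms, of h] by simp
  qed
qed

section \<open>Long zero-free and minimal zero sequences\<close>

text \<open>
  The multiplier \<open>g\<close> is the inverse of the common term \<open>a\<close> of \<open>long_zero_sum_free_multiples\<close>: it turns
  the term \<open>f a\<close> into \<open>f\<close>. If \<open>a\<close> had a common factor \<open>d > 1\<close> with \<open>n\<close>, then \<open>n / d \<le> n / 2\<close> copies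
  of \<open>a\<close> would have sum zero, although the order of \<open>a\<close> exceeds the length of the sequence.
\<close>

theorem long_zero_free_sum_less:
  assumes "n > 0" "zero_free n xs" "n < 2 * length xs"
  obtains g where "coprime g (int n)" "(\<Sum>a\<leftarrow>xs. representative n (g * a)) < n"
proof -
  let ?G = "range (residue n)" and ?A = "image_mset (residue n) (mset xs)"
  have zf: "zero_sum_free ?A"
    unfolding zero_sum_free_def
  proof (intro allI impI)
    fix N assume N: "N \<subseteq># ?A \<and> N \<noteq> {#}"
    then obtain ys where ys: "subseq ys xs" "image_mset (residue n) (mset ys) = N"
      using subseq_of_submultiset by blast
    then have "ys \<noteq> []" using N by auto
    then have "\<not> int n dvd sum_list ys" using ys assms by (simp add: zero_free_iff)
    then show "sum_mset N \<noteq> 0"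
      using assms(1) by (simp add: sum_residue_mset residue_eq_0_iff flip: ys(2))
  qed
  have fin: "finite ?G" by (simp add: range_residue assms(1))
  have cG: "card ?G \<le> n"
    unfolding range_residue[OF assms(1)] using card_image_le[of "{0..<int n}" "residue n"] by simp
  obtain c f where c: "c \<in># ?A"
    and f: "\<And>b. b \<in># ?A \<Longrightarrow> 0 < f b \<and> b = multiple (f b) c"
    and less: "(\<Sum>b\<in>#?A. f b) < card ?G"
    and nz: "\<And>j. 0 < j \<Longrightarrow> j \<le> (\<Sum>b\<in>#?A. f b) \<Longrightarrow> multiple j c \<noteq> 0"
  proof (rule long_zero_sum_free_multiples[of ?G ?A])
    show "0 \<in> ?G" by (metis rangeI residue_0)
    show "x + y \<in> ?G" if "x \<in> ?G" "y \<in> ?G" for x y using that by (auto simp flip: residue_add)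
    show "- x \<in> ?G" if "x \<in> ?G" for x using that by (auto simp flip: residue_minus)
    show "card ?G < 2 * size ?A" using cG assms(3) by simp
  qed (use fin zf in auto)
  obtain a where a: "c = residue n a" using c by auto
  define F where "F b = f (residue n b)" for b
  have F: "0 < F b \<and> [b = int (F b) * a] (mod int n)" if "b \<in> set xs" for b
    using f[of "residue n b"] that by (simp add: F_def a multiple_residue flip: residue_eq_iff[OF assms(1)])
  have sumF: "(\<Sum>b\<in>#?A. f b) = (\<Sum>b\<leftarrow>xs. F b)"
    by (simp add: F_def image_mset.compositionality comp_def flip: sum_mset_sum_list)
  have len: "length xs \<le> (\<Sum>b\<leftarrow>xs. F b)"
    using sum_list_mono[of xs "\<lambda>_. 1" F] F by (simp add: sum_list_triv Suc_le_eq)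
  have "coprime a (int n)"
  proof (rule ccontr)
    assume "\<not> coprime a (int n)"
    define d where "d = nat (gcd a (int n))"
    have d: "int d = gcd a (int n)" by (simp add: d_def)
    have "0 < gcd a (int n)" using assms(1) by simp
    then have "d \<noteq> 0" using d by linarith
    have "d \<noteq> 1" using \<open>\<not> coprime a (int n)\<close> d by (auto simp: coprime_iff_gcd_eq_1)
    have "int d dvd int n" "int d dvd a" by (simp_all add: d)
    then obtain k where k: "n = d * k" by auto
    then have "0 < k" using assms(1) by auto
    have "2 * k \<le> n" using k \<open>d \<noteq> 0\<close> \<open>d \<noteq> 1\<close> by simp
    then have "k \<le> (\<Sum>b\<in>#?A. f b)" using assms(3) len sumF by simp
    moreover have "int n dvd int k * a" using \<open>int d dvd a\<close> by (simp add: k mult.commute mult_dvd_mono)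
    then have "multiple k c = 0" by (simp add: a multiple_residue residue_eq_0_iff assms(1))
    ultimately show False using nz[OF \<open>0 < k\<close>] by blast
  qed
  then obtain g where g: "[a * g = 1] (mod int n)" using cong_solve_coprime_int by blast
  then have "coprime g (int n)"
    using coprime_iff_invertible_int[of g "int n"] by (auto simp: mult.commute)
  have rep: "representative n (g * b) = F b" if b: "b \<in> set xs" for b
  proof (rule representative_eqI)
    show "1 \<le> F b" using F[OF b] by simp
    have "F b \<le> (\<Sum>b\<leftarrow>xs. F b)" using b by (intro member_le_sum_list) auto
    then show "F b \<le> n" using less sumF cG by simp
    have "[g * b = g * (int (F b) * a)] (mod int n)" using F[OF b] by (intro cong_scalar_left) simp
    also have "g * (int (F b) * a) = int (F b) * (a * g)" by simp
    also have "[int (F b) * (a * g) = int (F b) * 1] (mod int n)" by (rule cong_scalar_left[OF g])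
    finally show "[int (F b) = g * b] (mod int n)" by (simp add: cong_sym_eq)
  qed
  have "(\<Sum>b\<leftarrow>xs. representative n (g * b)) = (\<Sum>b\<leftarrow>xs. F b)"
    by (intro arg_cong[of _ _ sum_list] map_cong) (use rep in auto)
  then show ?thesis using that[OF \<open>coprime g (int n)\<close>] less sumF cG by simp
qed

lemma long_minimal_zero_sequence_index:
  assumes "n > 0" "minimal_zero_sequence n xs" "n div 2 + 2 \<le> length xs"
  shows "seq_index n xs = n"
proof -
  obtain a ys where xs: "xs = a # ys" using assms(3) by (cases xs) auto
  have dvd: "int n dvd sum_list xs" using assms by (simp add: minimal_zero_sequence_iff)
  have "zero_free n ys"
    unfolding zero_free_iff[OF assms(1)]
  proof (intro conjI allI impI notI)
    fix zs assume zs: "subseq zs ys \<and> zs \<noteq> []" "int n dvd sum_list zs"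
    then have "subseq zs xs" by (simp add: xs list_emb_Cons)
    then have "zs = xs" using assms zs by (auto simp: minimal_zero_sequence_iff)
    then show False using zs by (auto simp: xs dest: list_emb_length)
  qed (use assms in \<open>auto simp: xs minimal_zero_sequence_iff\<close>)
  moreover have "n < 2 * length ys" using assms(3) by (simp add: xs)
  ultimately obtain g where g: "coprime g (int n)" "(\<Sum>a\<leftarrow>ys. representative n (g * a)) < n"
    using long_zero_free_sum_less[OF assms(1)] by blast
  let ?L = "\<Sum>a\<leftarrow>xs. representative n (g * a)"
  have "?L < 2 * n" using g(2) representative_props(2)[OF assms(1), of "g * a"] by (simp add: xs)
  moreover have "n dvd ?L" "n \<le> ?L" using representative_sum_ge[OF assms(1) dvd, of g] by (simp_all add: xs)
  ultimately have "?L = n" by (auto elim!: dvdE simp: xs)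
  then show ?thesis using seq_index_eq_iff[OF assms(1) dvd] g(1) by (auto simp: xs)
qed

section \<open>Minimal zero sequences of length floor(n/2) + 1 with larger index\<close>

lemma subseq_replicate:
  assumes "subseq ys (replicate v a)"
  obtains j where "j \<le> v" "ys = replicate j a"
proof -
  have "set ys \<subseteq> {a}" using set_mono_subseq[OF assms] by auto
  then have "ys = replicate (length ys) a" by (auto intro!: replicate_eqI)
  moreover have "length ys \<le> v" using list_emb_length[OF assms] by simp
  ultimately show ?thesis using that by blast
qed

text \<open>
  The integers themselves have sum \<open>2 n\<close>, so a zero subsequence other than the whole would have sum
  exactly \<open>n\<close>. The inequalities rule this out: with at most one of \<open>x, y, z\<close> the sum stays below
  \<open>n\<close>, with two of them it is already larger.
\<close>

lemma minimal_zero_sequence_ones_triple: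
  fixes x y z :: int
  assumes "x + y + z + int v = 2 * int n" "0 < n"
    and "x + int v < int n" "y + int v < int n" "z + int v < int n"
    and "int n < x + y" "int n < x + z" "int n < y + z"
  shows "minimal_zero_sequence n (replicate v 1 @ [x, y, z])"
  unfolding minimal_zero_sequence_iff[OF assms(2)]
proof (intro conjI allI impI)
  have pos: "0 < x" "0 < y" "0 < z" using assms by linarith+
  show "set (replicate v 1 @ [x, y, z]) \<subseteq> {0..<int n}"
    using assms pos by (auto simp: in_set_replicate)
  have "sum_list (replicate v 1 @ [x, y, z]) = 2 * int n"
    using assms(1) by (simp add: sum_list_replicate)
  then show "int n dvd sum_list (replicate v 1 @ [x, y, z])" by simp
  fix ys assume ys: "subseq ys (replicate v 1 @ [x, y, z]) \<and> ys \<noteq> [] \<and> int n dvd sum_list ys"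
  then obtain ys1 ys2 where "ys = ys1 @ ys2" "subseq ys1 (replicate v 1)" "subseq ys2 [x, y, z]"
    by (meson subseq_appendE)
  then obtain j where j: "j \<le> v" "ys = replicate j 1 @ ys2" "ys2 \<in> set (subseqs [x, y, z])"
    by (metis subseq_replicate in_set_subseqs)
  define s where "s = int j + sum_list ys2"
  have "int n dvd s" using ys by (simp add: j(2) sum_list_replicate s_def)
  then obtain q where q: "s = int n * q" by blast
  have "ys2 \<in> {[x, y, z], [x, y], [x, z], [x], [y, z], [y], [z], []}"
    using j(3) by (auto simp: Let_def)
  then have "0 < s \<and> s < int n \<or> int n < s \<and> s < 2 * int n \<or> ys2 = [x, y, z] \<and> j = v"
    using j(1) assms pos ys by (auto simp: s_def j(2))
  moreover have "\<not> (0 < s \<and> s < int n)"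
    using q zless_imp_add1_zle[of 0 q] assms(2) by (auto simp: zero_less_mult_iff)
  moreover have "\<not> (int n < s \<and> s < 2 * int n)"
  proof
    assume "int n < s \<and> s < 2 * int n"
    then have "int n * 1 < int n * q" "int n * q < int n * 2" using q by (simp_all add: mult.commute)
    then have "1 < q" "q < 2" using assms(2) by (simp_all only: mult_less_cancel_left_pos of_nat_0_less_iff)
    then show False by simp
  qed
  ultimately show "ys = replicate v 1 @ [x, y, z]" using j(2) by auto
qed

lemma representative_unit:
  assumes "1 < n" "coprime g (int n)"
  obtains r where "1 \<le> r" "r < n" "coprime r n" "[g = int r] (mod int n)" "representative n g = r"
proof -
  define r where "r = representative n g"
  have r: "1 \<le> r" "r \<le> n" "[int r = g] (mod int n)"
    using representative_props[of n g] assms(1) by (auto simp: r_def)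
  then have "coprime (int r) (int n)" using assms(2) cong_imp_coprime cong_sym by blast
  then have co: "coprime r n" by simp
  then have "r \<noteq> n" using assms(1) by auto
  then have "r < n" using r(2) by simp
  show ?thesis by (rule that[OF r(1) \<open>r < n\<close> co cong_sym[OF r(3)]]) (simp add: r_def)
qed

lemma index_ones_triple:
  assumes "1 < n" "int n dvd int v + x + y + z"
    and "\<And>r. 1 \<le> r \<Longrightarrow> r < n \<Longrightarrow> coprime r n \<Longrightarrow>
      v * r + representative n (int r * x) + representative n (int r * y) + representative n (int r * z) \<noteq> n"
  shows "seq_index n (replicate v 1 @ [x, y, z]) \<noteq> n"
proof
  let ?xs = "replicate v 1 @ [x, y, z]"
  assume "seq_index n ?xs = n"
  then obtain g where g: "coprime g (int n)" "(\<Sum>a\<leftarrow>?xs. representative n (g * a)) = n"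
    using assms(1,2) by (subst (asm) seq_index_eq_iff) (auto simp: sum_list_replicate algebra_simps)
  obtain r where r: "1 \<le> r" "r < n" "coprime r n" "[g = int r] (mod int n)" "representative n g = r"
    using representative_unit[OF assms(1) g(1)] .
  have "representative n (g * b) = representative n (int r * b)" for b
    using assms(1) r(4) by (intro representative_cong cong_scalar_right) auto
  note scale = this
  have "representative n (int r) = r" using scale[of 1] r(5) by simp
  then show False using g(2) assms(3)[OF r(1-3)] by (simp add: scale sum_list_replicate add.assoc)
qed

text \<open>
  The quotient \<open>q\<close> serves as an explicit witness of the congruence in the computations below.
\<close>

lemma representative_mod_eqI:
  assumes "1 \<le> b" "b \<le> int n" "a - b = int n * q"
  shows "int (representative n a) = b"
proof -
  have "[a = b] (mod int n)" by (simp add: cong_iff_dvd_diff assms(3))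
  then have "[int (nat b) = a] (mod int n)" using assms(1) by (simp add: cong_sym)
  then have "representative n a = nat b" using assms(1,2) by (intro representative_eqI) auto
  then show ?thesis using assms(1) by simp
qed

text \<open>
  The terms are \<open>m - 2\<close> ones, \<open>m\<close> and twice \<open>m + 1\<close>, where \<open>n = 2 m\<close>. A multiplier \<open>r\<close> is odd, so it
  fixes \<open>m\<close> and sends \<open>m + 1\<close> to \<open>m + r\<close> or \<open>r - m\<close>. The representatives have the sum \<open>m (r + 3)\<close> if
  \<open>r \<le> m\<close> and \<open>m (r - 1)\<close> otherwise; it could be \<open>n\<close> only for \<open>r = 3 > m\<close>.
\<close>

lemma even_example:
  assumes "n = 2 * m" "3 \<le> m"
  shows "\<exists>xs. minimal_zero_sequence n xs \<and> length xs = n div 2 + 1 \<and> seq_index n xs \<noteq> n"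
proof (intro exI conjI)
  let ?xs = "replicate (m - 2) 1 @ [int m, int m + 1, int m + 1]"
  show "minimal_zero_sequence n ?xs"
    using assms by (intro minimal_zero_sequence_ones_triple) auto
  show "length ?xs = n div 2 + 1" using assms by simp
  show "seq_index n ?xs \<noteq> n"
  proof (rule index_ones_triple)
    have "int (m - 2) + int m + (int m + 1) + (int m + 1) = 2 * int n" using assms by simp
    then show "int n dvd int (m - 2) + int m + (int m + 1) + (int m + 1)" by simp
    fix r assume r: "1 \<le> r" "r < n" "coprime r n"
    have "odd r" using r(3) assms(1) by auto
    then obtain h where h: "r = 2 * h + 1" by (elim oddE)
    have 1: "int (representative n (int r * int m)) = int m"
      by (rule representative_mod_eqI[of _ _ _ "int h"]) (use assms h in \<open>auto simp: algebra_simps\<close>)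
    show "(m - 2) * r + representative n (int r * int m) + representative n (int r * (int m + 1)) +
      representative n (int r * (int m + 1)) \<noteq> n"
    proof (cases "r \<le> m")
      case True
      have "int (representative n (int r * (int m + 1))) = int m + int r"
        by (rule representative_mod_eqI[of _ _ _ "int h"]) (use assms h True in \<open>auto simp: algebra_simps\<close>)
      then show ?thesis using 1 r(1) assms by simp
    next
      case False
      have 2: "int (representative n (int r * (int m + 1))) = int r - int m"
        by (rule representative_mod_eqI[of _ _ _ "int h + 1"]) (use assms h False r in \<open>auto simp: algebra_simps\<close>)
      have "int ((m - 2) * r) = (int m - 2) * int r" using assms by (simp add: of_nat_diff)
      then have "int ((m - 2) * r + representative n (int r * int m) + representative n (int r * (int m + 1)) +
          representative n (int r * (int m + 1))) = int m * (int r - 1)"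
        using 1 2 by (simp add: algebra_simps)
      moreover have "int m * (int r - 1) \<noteq> int m * 2" using False assms by simp
      ultimately show ?thesis using assms(1) by linarith
    qed
  qed (use assms in simp)
qed

text \<open>
  The terms are \<open>k - 2\<close> ones, \<open>k\<close> and twice \<open>k + 2\<close>, where \<open>n = 2 k + 1\<close>. As \<open>2 k\<close> is \<open>- 1\<close> modulo
  \<open>n\<close>, a multiplier \<open>r = 2 h\<close> sends \<open>k\<close> to \<open>- h\<close> and \<open>k + 2\<close> to \<open>3 h\<close>, while \<open>r = 2 h + 1\<close> sends \<open>k\<close>
  to \<open>k - h\<close> and \<open>k + 2\<close> to \<open>k + 3 h + 2\<close>. The sums are \<open>c n\<close> with \<open>c\<close> equal to \<open>h + 1\<close> or \<open>h + 2\<close>,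
  diminished by \<open>2\<close> if the image of \<open>k + 2\<close> has to be reduced. In the reduced cases \<open>c = 1\<close> would mean
  \<open>h = 2\<close> and \<open>6 > n\<close>, or \<open>h = 1\<close> and \<open>k + 5 > n\<close>; both fail for \<open>n \<ge> 9\<close>.
\<close>

lemma odd_example:
  assumes "n = 2 * k + 1" "4 \<le> k"
  shows "\<exists>xs. minimal_zero_sequence n xs \<and> length xs = n div 2 + 1 \<and> seq_index n xs \<noteq> n"
proof (intro exI conjI)
  let ?xs = "replicate (k - 2) 1 @ [int k, int k + 2, int k + 2]"
  show "minimal_zero_sequence n ?xs"
    using assms by (intro minimal_zero_sequence_ones_triple) auto
  show "length ?xs = n div 2 + 1" using assms by simp
  show "seq_index n ?xs \<noteq> n"
  proof (rule index_ones_triple)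
    have "int (k - 2) + int k + (int k + 2) + (int k + 2) = 2 * int n" using assms by simp
    then show "int n dvd int (k - 2) + int k + (int k + 2) + (int k + 2)" by simp
    fix r assume r: "1 \<le> r" "r < n" "coprime r n"
    have v: "int ((k - 2) * r) = (int k - 2) * int r" using assms by (simp add: of_nat_diff)
    let ?x = "representative n (int r * int k)" and ?y = "representative n (int r * (int k + 2))"
    have "\<exists>c. int ((k - 2) * r) + int ?x + int ?y + int ?y = c * int n \<and> c \<noteq> 1"
    proof (cases "even r")
      case True
      then obtain h where h: "r = 2 * h" by (elim evenE)
      have x: "int ?x = int n - int h"
        by (rule representative_mod_eqI[of _ _ _ "int h - 1"]) (use assms h r in \<open>auto simp: algebra_simps\<close>)
      show ?thesis
      proof (cases "3 * h \<le> n")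
        case True
        have "int ?y = 3 * int h"
          by (rule representative_mod_eqI[of _ _ _ "int h"]) (use assms h True r in \<open>auto simp: algebra_simps\<close>)
        then show ?thesis unfolding v x using assms h r
          by (intro exI[of _ "int h + 1"]) (simp add: algebra_simps)
      next
        case False
        have "int ?y = 3 * int h - int n"
          by (rule representative_mod_eqI[of _ _ _ "int h + 1"]) (use assms h False r in \<open>auto simp: algebra_simps\<close>)
        then show ?thesis unfolding v x using assms h r False
          by (intro exI[of _ "int h - 1"]) (simp add: algebra_simps)
      qed
    next
      case False
      then obtain h where h: "r = 2 * h + 1" by (elim oddE)
      have x: "int ?x = int k - int h"
        by (rule representative_mod_eqI[of _ _ _ "int h"]) (use assms h r in \<open>auto simp: algebra_simps\<close>)
      show ?thesis
      proof (cases "k + 3 * h + 2 \<le> n")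
        case True
        have "int ?y = int k + 3 * int h + 2"
          by (rule representative_mod_eqI[of _ _ _ "int h"]) (use assms h True r in \<open>auto simp: algebra_simps\<close>)
        then show ?thesis unfolding v x using assms h r
          by (intro exI[of _ "int h + 2"]) (simp add: algebra_simps)
      next
        case False
        have "int ?y = int k + 3 * int h + 2 - int n"
          by (rule representative_mod_eqI[of _ _ _ "int h + 1"]) (use assms h False r in \<open>auto simp: algebra_simps\<close>)
        then show ?thesis unfolding v x using assms h r False
          by (intro exI[of _ "int h"]) (simp add: algebra_simps)
      qed
    qed
    then obtain c where c: "int ((k - 2) * r + ?x + ?y + ?y) = c * int n" "c \<noteq> 1" by auto
    show "(k - 2) * r + ?x + ?y + ?y \<noteq> n"
    proof
      assume "(k - 2) * r + ?x + ?y + ?y = n"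
      then have "c * int n = int n" using c(1) by metis
      then show False using c(2) assms by simp
    qed
  qed (use assms in simp)
qed

section \<open>The exceptional moduli\<close>

text \<open>
  If there is more than one term, no term is zero, so the representatives of \<open>a\<close> and \<open>- a\<close> add up to
  \<open>n\<close>. Hence \<open>L(\<alpha>) + L(- \<alpha>)\<close> is \<open>n\<close> times the length, at most \<open>3 n\<close>, and one of these two positive
  multiples of \<open>n\<close> is \<open>n\<close>.
\<close>

lemma short_minimal_zero_sequence_index:
  assumes "1 < n" "minimal_zero_sequence n xs" "xs \<noteq> []" "length xs \<le> 3"
  shows "seq_index n xs = n"
proof -
  have n: "n > 0" using assms(1) by simp
  have dvd: "int n dvd sum_list xs" using assms(2) by (simp add: minimal_zero_sequence_iff n)
  let ?L = "\<lambda>g. \<Sum>a\<leftarrow>xs. representative n (g * a)"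
  note ge = representative_sum_ge[OF n dvd assms(3)]
  have "?L 1 = n \<or> ?L (- 1) = n"
  proof (cases "length xs = 1")
    case True
    then obtain a where "xs = [a]" by (auto simp: length_Suc_conv)
    then show ?thesis using ge(2)[of 1] representative_props(2)[OF n, of a] by simp
  next
    case False
    have neg: "representative n a + representative n (- a) = n" if a: "a \<in> set xs" for a
    proof -
      have "\<not> int n dvd a"
      proof
        assume "int n dvd a"
        moreover have "subseq [a] xs" using a by (simp add: subseq_singleton_left)
        ultimately have "[a] = xs" using assms(2) by (auto simp: minimal_zero_sequence_iff n)
        then show False using False by auto
      qed
      note p = representative_props[OF n, of a]
      have "representative n a \<noteq> n"
      proof
        assume "representative n a = n"
        then have "[int n = a] (mod int n)" using p(3) by simp
        then show False using \<open>\<not> int n dvd a\<close> by (simp add: cong_def dvd_eq_mod_eq_0)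
      qed
      moreover have "[int (n - representative n a) = - a] (mod int n)"
      proof -
        have "[int n - int (representative n a) = 0 - a] (mod int n)"
          by (intro cong_diff p(3)) (simp add: cong_def)
        then show ?thesis using p(2) by (simp add: of_nat_diff)
      qed
      ultimately have "representative n (- a) = n - representative n a"
        using p by (intro representative_eqI) auto
      then show ?thesis using p(2) by simp
    qed
    have "?L 1 + ?L (- 1) = (\<Sum>a\<leftarrow>xs. representative n a + representative n (- a))"
      by (simp add: sum_list_addf)
    also have "\<dots> = (\<Sum>a\<leftarrow>xs. n)" by (intro arg_cong[of _ _ sum_list] map_cong) (use neg in auto)
    also have "\<dots> = length xs * n" by (simp add: sum_list_triv)
    also have "\<dots> \<le> 3 * n" using assms(4) by (rule mult_le_mono1)
    finally have "?L 1 \<le> 2 * n" "?L 1 = 2 * n \<longrightarrow> ?L (- 1) \<le> n"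
      using ge(2)[of "- 1"] by linarith+
    moreover obtain q where "?L 1 = n * q" using ge(1)[of 1] by blast
    ultimately have "q \<le> 2" "q \<noteq> 0" using n ge(2)[of 1] by auto
    then have "?L 1 = n \<or> ?L 1 = 2 * n" using \<open>?L 1 = n * q\<close> by (cases "q = 1") auto
    then show ?thesis using \<open>?L 1 = 2 * n \<longrightarrow> ?L (- 1) \<le> n\<close> ge(2)[of "- 1"] by auto
  qed
  moreover have "coprime 1 (int n)" "coprime (- 1) (int n)" by simp_all
  ultimately show ?thesis using seq_index_eq_iff[OF n dvd assms(3)] by blast
qed

text \<open>
  The excluded pairs contain the first term only: if a pair of the other three terms had
  sum zero modulo \<open>7\<close>, then so would the complementary pair.
\<close>

lemma four_residues_mod_7:
  "\<forall>a \<in> set [1,2,3,4,5,6::int]. \<forall>b \<in> set [1,2,3,4,5,6]. \<forall>c \<in> set [1,2,3,4,5,6]. \<forall>d \<in> set [1,2,3,4,5,6].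
     (a + b + c + d) mod 7 = 0 \<longrightarrow> a + b \<noteq> 7 \<longrightarrow> a + c \<noteq> 7 \<longrightarrow> a + d \<noteq> 7 \<longrightarrow>
     (\<exists>g \<in> set [1,2,3,4,5,6]. 0 < g * a mod 7 \<and> 0 < g * b mod 7 \<and> 0 < g * c mod 7 \<and> 0 < g * d mod 7 \<and>
        g * a mod 7 + g * b mod 7 + g * c mod 7 + g * d mod 7 = 7)"
  by code_simp

lemma coprime_to_7: "\<forall>g \<in> set [1,2,3,4,5,6::int]. coprime g 7"
  by code_simp

lemma minimal_zero_sequence_7_4_index:
  assumes "minimal_zero_sequence 7 xs" "length xs = 4"
  shows "seq_index 7 xs = 7"
proof -
  obtain a b c d where xs: "xs = [a, b, c, d]"
    using assms(2) by (auto simp: length_Suc_conv numeral_eq_Suc)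
  have min: "\<not> 7 dvd sum_list ys" if "subseq ys xs" "ys \<noteq> []" "length ys < 4" for ys
    using assms that by (auto simp: minimal_zero_sequence_iff)
  have range: "set xs \<subseteq> {0..<7}" and dvd: "7 dvd sum_list xs"
    using assms(1) by (auto simp: minimal_zero_sequence_iff)
  have "x \<noteq> 0" if "x \<in> set xs" for x
    using min[of "[x]"] that by (auto simp: subseq_singleton_left)
  then have "set xs \<subseteq> {1..6}" using range by force
  moreover have "{1..6} = set [1,2,3,4,5,6::int]" by auto
  ultimately have S: "a \<in> set [1,2,3,4,5,6]" "b \<in> set [1,2,3,4,5,6]" "c \<in> set [1,2,3,4,5,6]" "d \<in> set [1,2,3,4,5,6]"
    unfolding xs by auto
  have pairs: "subseq [a, b] xs" "subseq [a, c] xs" "subseq [a, d] xs"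
    by (simp_all add: xs split: if_split)
  have neq: "a + b \<noteq> 7" "a + c \<noteq> 7" "a + d \<noteq> 7"
    using min[OF pairs(1)] min[OF pairs(2)] min[OF pairs(3)] by auto
  have sum: "(a + b + c + d) mod 7 = 0" using dvd by (simp add: xs dvd_eq_mod_eq_0 add.assoc)
  obtain g where g: "g \<in> set [1,2,3,4,5,6]"
    "0 < g * a mod 7" "0 < g * b mod 7" "0 < g * c mod 7" "0 < g * d mod 7"
    "g * a mod 7 + g * b mod 7 + g * c mod 7 + g * d mod 7 = 7"
    using four_residues_mod_7[THEN bspec, OF S(1), THEN bspec, OF S(2), THEN bspec, OF S(3),
        THEN bspec, OF S(4), THEN mp, OF sum, THEN mp, OF neq(1), THEN mp, OF neq(2), THEN mp, OF neq(3)]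
    by (elim bexE conjE)
  have rep: "int (representative 7 x) = x mod 7" if "0 < x mod 7" for x
    by (rule representative_mod_eqI[of _ _ _ "x div 7"]) (use that in \<open>auto simp: minus_mod_eq_mult_div less_imp_le\<close>)
  have "int (\<Sum>x\<leftarrow>xs. representative 7 (g * x)) = 7"
    using g(6) by (simp add: xs rep g(2-5))
  then have "(\<Sum>x\<leftarrow>xs. representative 7 (g * x)) = 7" by linarith
  moreover have "coprime g (int 7)" using bspec[OF coprime_to_7 g(1)] by simp
  ultimately show ?thesis using seq_index_eq_iff[of 7 xs] dvd by (auto simp: xs)
qed

text \<open>
  For these moduli every length is at most \<open>3\<close> or at least \<open>\<lfloor>n / 2\<rfloor> + 2\<close>, except for length \<open>4\<close>
  modulo \<open>7\<close>.
\<close>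

lemma exceptional_index:
  assumes "n \<in> {2, 3, 4, 5, 7}" "minimal_zero_sequence n xs" "xs \<noteq> []"
  shows "seq_index n xs = n"
proof -
  consider "length xs \<le> 3" | "n div 2 + 2 \<le> length xs" | "n = 7" "length xs = 4"
    using assms(1) by fastforce
  then show ?thesis
  proof cases
    case 1
    then show ?thesis using short_minimal_zero_sequence_index[OF _ assms(2,3)] assms(1) by auto
  next
    case 2
    then show ?thesis using long_minimal_zero_sequence_index[OF _ assms(2)] assms(1) by auto
  next
    case 3
    then show ?thesis using minimal_zero_sequence_7_4_index assms(2) by simp
  qed
qed

lemma extremal_example:
  assumes "1 < n" "n \<notin> {2, 3, 4, 5, 7}"
  shows "\<exists>xs. minimal_zero_sequence n xs \<and> length xs = n div 2 + 1 \<and> seq_index n xs \<noteq> n"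
proof (cases "even n")
  case True
  then obtain m where "n = 2 * m" by (elim evenE)
  then show ?thesis using even_example[of n m] assms by auto
next
  case False
  then obtain k where "n = 2 * k + 1" by (elim oddE)
  then show ?thesis using odd_example[of n k] assms by auto
qed

section \<open>The values of ell\<close>

theorem proposition10:
  fixes n :: nat
  assumes "n > 1"
  shows "(n \<notin> {2, 3, 4, 5, 7} \<longrightarrow> int (ell n) = \<lfloor>real n / 2\<rfloor> + 2) \<and>
         (n \<in> {2, 3, 4, 5, 7} \<longrightarrow> ell n = 1)"
proof (intro conjI impI)
  assume n: "n \<notin> {2, 3, 4, 5, 7}"
  obtain xs where xs: "minimal_zero_sequence n xs" "length xs = n div 2 + 1" "seq_index n xs \<noteq> n"
    using extremal_example[OF assms n] by blast
  have "ell n = n div 2 + 2"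
    unfolding ell_def
  proof (rule Least_equality)
    show "0 < n div 2 + 2 \<and> (\<forall>\<alpha>. minimal_zero_sequence n \<alpha> \<and> n div 2 + 2 \<le> length \<alpha> \<longrightarrow> seq_index n \<alpha> = n)"
      using long_minimal_zero_sequence_index assms by auto
    fix l assume "0 < l \<and> (\<forall>\<alpha>. minimal_zero_sequence n \<alpha> \<and> l \<le> length \<alpha> \<longrightarrow> seq_index n \<alpha> = n)"
    then have "\<not> l \<le> length xs" using xs by blast
    then show "n div 2 + 2 \<le> l" using xs(2) by simp
  qed
  moreover have "\<lfloor>real n / 2\<rfloor> = int (n div 2)" using floor_divide_of_nat_eq[of n 2, where 'a = real] by simp
  ultimately show "int (ell n) = \<lfloor>real n / 2\<rfloor> + 2" by simp
next
  assume n: "n \<in> {2, 3, 4, 5, 7}"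
  show "ell n = 1"
    unfolding ell_def
  proof (rule Least_equality)
    have "seq_index n \<alpha> = n" if "minimal_zero_sequence n \<alpha>" "1 \<le> length \<alpha>" for \<alpha>
      using exceptional_index[OF n that(1)] that(2) by fastforce
    then show "0 < (1::nat) \<and> (\<forall>\<alpha>. minimal_zero_sequence n \<alpha> \<and> 1 \<le> length \<alpha> \<longrightarrow> seq_index n \<alpha> = n)"
      by simp
  qed simp
qed

end
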